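(* Let $p$ be a prime, $m\in\mathbb{N}$ with $m\ge 1$, $n=p^m$, and $S=\{a\in\mathbb{Z}_n \mid \gcd(a,n)=1\}$. Then the adjacency spectrum of the Cayley graph $\Gamma=\mathrm{Cay}(\mathbb{Z}_n,S)$ is $$\{\,n-p^{m-1},\ 0^{(n-p)},\ (-p^{m-1})^{(p-1)}\,\}.$$
   Context: For a finite group $G$ and an inverse-closed subset $H\subseteq G$ not containing the identity, $\mathrm{Cay}(G,H)$ is the simple undirected graph with vertex set $G$ in which $x,y$ are adjacent iff $x^{-1}y\in H$. Here $G=\mathbb{Z}_n$ is the additive cyclic group, so $x,y$ are adjacent iff $y-x\in S$. The adjacency spectrum is the multiset of eigenvalues of the adjacency matrix; a superscript in parentheses denotes the multiplicity (no superscript means multiplicity one; multiplicity $0$ means the value does not occur). *)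

theory Defs
  imports
    "HOL-Algebra.Elementary_Groups"
    "HOL-Computational_Algebra.Computational_Algebra"
    "Graph_Theory.Pair_Digraph"
    "Jordan_Normal_Form.Char_Poly"
begin

text \<open>
  An undirected edge is represented by its two opposite arcs, as in the locale \<open>pair_graph\<close>
  of simple undirected graphs.
\<close>

definition Cay :: "('a, 'b) monoid_scheme \<Rightarrow> 'a set \<Rightarrow> 'a pair_pre_digraph" where
  "Cay G H = \<lparr> pverts = carrier G,
     parcs = {(x, y). x \<in> carrier G \<and> y \<in> carrier G \<and> inv\<^bsub>G\<^esub> x \<otimes>\<^bsub>G\<^esub> y \<in> H} \<rparr>"

lemma pair_graph_Cay:
  assumes "group G" "finite (carrier G)" "H \<subseteq> carrier G"
    and inverse_closed: "\<And>h. h \<in> H \<Longrightarrow> inv\<^bsub>G\<^esub> h \<in> H"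
    and no_one: "\<one>\<^bsub>G\<^esub> \<notin> H"
  shows "pair_graph (Cay G H)"
proof -
  interpret group G by fact
  have "finite (carrier G \<times> carrier G)" using assms by simp
  then have fin: "finite (parcs (Cay G H))"
    by (rule finite_subset[rotated]) (auto simp: Cay_def)
  have "inv\<^bsub>G\<^esub> y \<otimes>\<^bsub>G\<^esub> x \<in> H"
    if "x \<in> carrier G" "y \<in> carrier G" "inv\<^bsub>G\<^esub> x \<otimes>\<^bsub>G\<^esub> y \<in> H" for x y
    using inverse_closed[OF that(3)] that by (simp add: inv_mult_group)
  then have sym: "symmetric (with_proj (Cay G H))"
    by (auto simp: symmetric_def Cay_def intro!: symI)
  show ?thesis
    using assms(2) fin sym no_one
    by unfold_locales (auto simp: Cay_def)
qed

text \<open>Rows and columns follow the enumeration \<open>vs\<close> of the vertices.\<close>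

definition adjacency_matrix :: "'a pair_pre_digraph \<Rightarrow> 'a list \<Rightarrow> complex mat" where
  "adjacency_matrix \<Gamma> vs = mat (length vs) (length vs)
     (\<lambda>(i, j). if (vs ! i, vs ! j) \<in> parcs \<Gamma> then 1 else 0)"

text \<open>
  The eigenvalues counted with algebraic multiplicity. For finite \<open>\<Gamma>\<close> the choice of the
  enumeration is immaterial, see \<open>adjacency_spectrum_eq\<close> below.
\<close>

definition adjacency_spectrum :: "'a pair_pre_digraph \<Rightarrow> complex multiset" where
  "adjacency_spectrum \<Gamma> =
     proots (char_poly (adjacency_matrix \<Gamma> (SOME vs. distinct vs \<and> set vs = pverts \<Gamma>)))"

lemma similar_adjacency_matrix:
  assumes "distinct vs" "distinct ws" "set vs = set ws"
  shows "similar_mat (adjacency_matrix \<Gamma> vs) (adjacency_matrix \<Gamma> ws)"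
proof -
  define n where "n = length vs"
  have lws: "length ws = n"
    using assms by (metis distinct_card n_def)
  have lvs: "length vs = n" by (simp add: n_def)
  have "\<exists>k. k < n \<and> ws ! k = vs ! i" if "i < n" for i
    using that assms(3) lws lvs by (metis in_set_conv_nth nth_mem)
  then obtain f where f: "\<And>i. i < n \<Longrightarrow> f i < n \<and> ws ! f i = vs ! i"
    by metis
  have fiff: "vs ! i = ws ! k \<longleftrightarrow> k = f i" if "i < n" "k < n" for i k
    using f[of i] that nth_eq_iff_index_eq[OF assms(2)] lws by metis
  define P :: "complex mat" where "P = mat n n (\<lambda>(i, j). if vs ! i = ws ! j then 1 else 0)"
  define Q :: "complex mat" where "Q = mat n n (\<lambda>(i, j). if vs ! j = ws ! i then 1 else 0)"
  let ?A = "adjacency_matrix \<Gamma> vs" and ?B = "adjacency_matrix \<Gamma> ws"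
  have carr: "{?A, ?B, P, Q} \<subseteq> carrier_mat n n"
    by (auto simp: adjacency_matrix_def P_def Q_def lws lvs)
  have PQ: "P * Q = 1\<^sub>m n"
  proof (rule eq_matI)
    fix i j assume "i < dim_row (1\<^sub>m n :: complex mat)" "j < dim_col (1\<^sub>m n :: complex mat)"
    then have ij: "i < n" "j < n" by auto
    have "(P * Q) $$ (i, j) =
        (\<Sum>k = 0..<n. (if k = f i then 1 else 0) * (if vs ! j = ws ! k then 1 else 0))"
      using ij by (auto simp: P_def Q_def scalar_prod_def fiff intro!: sum.cong)
    also have "\<dots> = (if vs ! j = ws ! f i then 1 else 0)"
      using f[of i] ij by (simp add: if_distrib[where f = "\<lambda>x. x * _"] cong: if_cong)
    also have "\<dots> = 1\<^sub>m n $$ (i, j)"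
      using f[of i] ij nth_eq_iff_index_eq[OF assms(1)] lvs by auto
    finally show "(P * Q) $$ (i, j) = 1\<^sub>m n $$ (i, j)" .
  qed (auto simp: P_def Q_def)
  have QP: "Q * P = 1\<^sub>m n"
    by (rule mat_mult_left_right_inverse[OF _ _ PQ]) (auto simp: P_def Q_def)
  have "?A = P * ?B * Q"
  proof (rule eq_matI)
    fix i j assume "i < dim_row (P * ?B * Q)" "j < dim_col (P * ?B * Q)"
    then have ij: "i < n" "j < n" by (auto simp: P_def Q_def)
    have PB: "(P * ?B) $$ (i, k) = ?B $$ (f i, k)" if "k < n" for k
    proof -
      have "(P * ?B) $$ (i, k) = (\<Sum>l = 0..<n. (if l = f i then 1 else 0) * ?B $$ (l, k))"
        using ij that
        by (auto simp: P_def adjacency_matrix_def lws scalar_prod_def fiff intro!: sum.cong)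
      also have "\<dots> = ?B $$ (f i, k)"
        using f[of i] ij by (simp add: if_distrib[where f = "\<lambda>x. x * _"] cong: if_cong)
      finally show ?thesis .
    qed
    have "(P * ?B * Q) $$ (i, j) =
        (\<Sum>k = 0..<n. (P * ?B) $$ (i, k) * (if vs ! j = ws ! k then 1 else 0))"
      using ij unfolding Q_def
      by (subst index_mult_mat)
         (auto simp: P_def adjacency_matrix_def lws scalar_prod_def intro!: sum.cong)
    also have "\<dots> = (\<Sum>k = 0..<n. ?B $$ (f i, k) * (if k = f j then 1 else 0))"
      using ij by (intro sum.cong) (auto simp: PB fiff)
    also have "\<dots> = ?B $$ (f i, f j)"
      using f[of j] ij by (simp add: if_distrib[where f = "\<lambda>x. _ * x"] cong: if_cong)
    also have "\<dots> = ?A $$ (i, j)"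
      using ij f[of i] f[of j] by (simp add: adjacency_matrix_def lws lvs)
    finally show "?A $$ (i, j) = (P * ?B * Q) $$ (i, j)" by simp
  qed (auto simp: adjacency_matrix_def P_def Q_def lvs)
  then show ?thesis
    using similar_matI[OF carr PQ QP] by simp
qed

lemma adjacency_spectrum_eq:
  assumes "distinct vs" "set vs = pverts \<Gamma>"
  shows "adjacency_spectrum \<Gamma> = proots (char_poly (adjacency_matrix \<Gamma> vs))"
proof -
  let ?P = "\<lambda>vs. distinct vs \<and> set vs = pverts \<Gamma>"
  have "?P (SOME vs. ?P vs)"
    by (rule someI[of ?P vs]) (use assms in auto)
  then have "similar_mat (adjacency_matrix \<Gamma> (SOME vs. ?P vs)) (adjacency_matrix \<Gamma> vs)"
    using assms by (intro similar_adjacency_matrix) auto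
  then show ?thesis
    by (simp add: adjacency_spectrum_def char_poly_similar)
qed

end

theory Submission
  imports Defs
begin

text \<open>
  The adjacency matrix of a Cayley graph of \<open>\<int>\<^sub>n\<close> is diagonalised by the Fourier matrix
  \<open>(\<omega>\<^bsup>ij\<^esup>)\<close>, where \<open>\<omega>\<close> is a primitive \<open>n\<close>-th root of unity. For \<open>n = p\<^sup>m\<close>, an element is coprime
  to \<open>n\<close> iff it is not divisible by \<open>p\<close>, so with \<open>q = n / p\<close> the \<open>k\<close>-th eigenvalue is a full
  geometric sum, which is \<open>n\<close> if \<open>k = 0\<close> and \<open>0\<close> otherwise, minus a geometric sum over the multiples
  of \<open>p\<close>, which is \<open>q\<close> if \<open>q\<close> divides \<open>k\<close> and \<open>0\<close> otherwise.
\<close>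

text \<open>The equivalence encodes primitivity. For \<open>cis (2 * pi / real n)\<close> it holds
  because exponents may be reduced modulo \<open>n\<close> and the \<open>n\<close> powers with
  exponent below \<open>n\<close> are distinct.\<close>

lemma primitive_root_of_unity_exists:
  assumes "n > 0"
  obtains w :: complex where "\<And>k. w ^ k = 1 \<longleftrightarrow> n dvd k"
proof
  define w where "w = cis (2 * pi / real n)"
  have pow: "w ^ k = cis (2 * pi * real k / real n)" for k
    by (simp add: w_def DeMoivre mult_ac)
  have "w ^ n = 1"
    using assms by (simp add: pow)
  then have mod: "w ^ k = w ^ (k mod n)" for k
    by (metis mod_mult_div_eq power_add power_mult power_one mult.right_neutral)
  have "inj_on (\<lambda>k. w ^ k) {..<n}"
    using bij_betw_roots_unity[OF assms] by (simp add: bij_betw_def pow)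
  then have "w ^ (k mod n) = w ^ 0 \<longleftrightarrow> k mod n = 0" for k
    using assms by (subst inj_on_eq_iff) auto
  then show "w ^ k = 1 \<longleftrightarrow> n dvd k" for k
    using mod[of k] by (simp add: dvd_eq_mod_eq_0)
qed

lemma sum_powers_root_of_unity:
  fixes z :: "'a :: field"
  assumes "z ^ N = 1"
  shows "(\<Sum>t = 0..<N. z ^ t) = (if z = 1 then of_nat N else 0)"
  using assms geometric_sum[of z N] by (simp add: atLeast0LessThan)

lemma proots_prod_list_linear:
  "proots (\<Prod>a\<leftarrow>as. [:- a, 1:]) = mset (as :: 'a :: idom list)"
proof (induction as)
  case (Cons a as)
  have "(\<Prod>a\<leftarrow>as. [:- a, 1:]) \<noteq> 0"
    by (auto simp: prod_list_zero_iff)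
  then show ?case
    using Cons by (simp add: proots_mult del: mult_pCons_left)
qed simp

lemma proots_char_poly_mat_diag:
  "proots (char_poly (mat_diag n f)) = image_mset f (mset_set {0..<n})"
proof -
  have "upper_triangular (mat_diag n f)"
    by (auto simp: mat_diag_def)
  then have "char_poly (mat_diag n f) = (\<Prod>a\<leftarrow>diag_mat (mat_diag n f). [:- a, 1:])"
    by (intro char_poly_upper_triangular[of _ n]) auto
  moreover have "diag_mat (mat_diag n f) = map f [0..<n]"
    by (simp add: diag_mat_def mat_diag_def)
  ultimately show ?thesis
    by (simp only: proots_prod_list_linear mset_map mset_upt)
qed

text \<open>Hypothesis \<open>eigen\<close> says that the \<open>k\<close>-th column of the Fourier
  matrix is an eigenvector for \<open>ev k\<close>. These columns form an invertible matrix, so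
  \<open>A\<close> is similar to the diagonal matrix of the values \<open>ev k\<close>, and
  multiplicities are preserved.\<close>

lemma proots_char_poly_fourier:
  fixes A :: "'a :: field_char_0 mat"
  assumes A: "A \<in> carrier_mat n n"
    and w: "\<And>k. w ^ k = 1 \<longleftrightarrow> n dvd k"
    and eigen: "\<And>i k. i < n \<Longrightarrow> k < n \<Longrightarrow>
      (\<Sum>j = 0..<n. A $$ (i, j) * w ^ (j * k)) = w ^ (i * k) * ev k"
  shows "proots (char_poly A) = image_mset ev (mset_set {0..<n})"
\<comment> \<open>For \<open>n = 0\<close> the hypothesis on \<open>w\<close> does not even exclude
  \<open>w = 0\<close>, and the inverse matrix below divides by \<open>n\<close>.\<close>
proof (cases "n = 0")
  case True
  then have "A = mat_diag n ev"
    using A by (intro eq_matI) (auto simp: mat_diag_def)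
  then show ?thesis
    by (simp add: proots_char_poly_mat_diag)
next
  case False
  define P where "P = mat n n (\<lambda>(i, j). w ^ (i * j))"
  \<comment> \<open>Over the complex numbers this is the conjugate transpose of \<open>P\<close>
    divided by \<open>n\<close>; \<open>inverse w\<close> replaces conjugation in a general
    field.\<close>
  define Q where "Q = mat n n (\<lambda>(i, j). inverse w ^ (i * j) / of_nat n)"
  let ?D = "mat_diag n ev"
  have P: "P \<in> carrier_mat n n" and Q: "Q \<in> carrier_mat n n"
    by (auto simp: P_def Q_def)
  have wn: "w ^ n = 1" using w by simp
  have w0: "w \<noteq> 0" using wn False by (auto simp: zero_power)
  have inj: "w ^ i / w ^ j = 1 \<longleftrightarrow> i = j" if "i < n" "j < n" for i j
    using that
  proof (induction i j rule: linorder_wlog)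
    case (le i j)
    have "w ^ j = w ^ i * w ^ (j - i)"
      using le by (simp flip: power_add)
    then have "w ^ i / w ^ j = 1 \<longleftrightarrow> w ^ (j - i) = 1"
      using w0 by (auto simp: field_simps)
    also have "\<dots> \<longleftrightarrow> i = j"
      using le by (auto simp: w dest: dvd_imp_le)
    finally show ?case .
  next
    case (sym i j)
    then show ?case using w0 by (auto simp: field_simps)
  qed
  have PQ: "P * Q = 1\<^sub>m n"
  proof (rule eq_matI)
    fix i j assume "i < dim_row (1\<^sub>m n :: 'a mat)" "j < dim_col (1\<^sub>m n :: 'a mat)"
    then have ij: "i < n" "j < n" by auto
    \<comment> \<open>Orthogonality of characters: each entry is a geometric sum whose ratio is an
      \<open>n\<close>-th root of unity, equal to 1 only on the diagonal.\<close>
    have "(P * Q) $$ (i, j) = (\<Sum>k = 0..<n. w ^ (i * k) * (inverse w ^ (k * j) / of_nat n))"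
      using ij by (simp add: P_def Q_def scalar_prod_def)
    also have "\<dots> = (\<Sum>k = 0..<n. (w ^ i / w ^ j) ^ k) / of_nat n"
      by (simp add: sum_divide_distrib power_mult power_divide field_simps
            flip: power_mult)
    also have "(\<Sum>k = 0..<n. (w ^ i / w ^ j) ^ k) = (if w ^ i / w ^ j = 1 then of_nat n else 0)"
    proof (rule sum_powers_root_of_unity)
      show "(w ^ i / w ^ j) ^ n = 1"
        using w[of "i * n"] w[of "j * n"] by (simp add: power_divide flip: power_mult)
    qed
    also have "\<dots> / of_nat n = 1\<^sub>m n $$ (i, j)"
      using ij False by (simp only: inj) simp
    finally show "(P * Q) $$ (i, j) = 1\<^sub>m n $$ (i, j)" .
  qed (auto simp: P_def Q_def)
  have QP: "Q * P = 1\<^sub>m n"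
    by (rule mat_mult_left_right_inverse[OF P Q PQ])
  have AP: "A * P = P * ?D"
  proof (rule eq_matI)
    fix i k assume "i < dim_row (P * ?D)" "k < dim_col (P * ?D)"
    then have ik: "i < n" "k < n" by (auto simp: P_def mat_diag_def)
    have "(A * P) $$ (i, k) = (\<Sum>j = 0..<n. A $$ (i, j) * w ^ (j * k))"
      using ik A by (simp add: P_def scalar_prod_def)
    also have "\<dots> = (P * ?D) $$ (i, k)"
      using ik by (simp add: eigen mat_diag_mult_right[OF P]) (simp add: P_def)
    finally show "(A * P) $$ (i, k) = (P * ?D) $$ (i, k)" .
  qed (use A in \<open>auto simp: P_def mat_diag_def\<close>)
  have "A = A * (P * Q)"
    using A by (simp add: PQ)
  also have "\<dots> = P * ?D * Q"
    using A P Q AP by (simp flip: assoc_mult_mat[OF A P Q])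
  finally have "similar_mat A ?D"
    using A P Q PQ QP by (intro similar_matI[of _ _ P Q n]) auto
  then show ?thesis
    by (simp add: char_poly_similar proots_char_poly_mat_diag)
qed

text \<open>Division with remainder by \<open>p\<close> turns a residue class into an arithmetic
  progression, over which powers of \<open>w\<close> form a geometric sum.\<close>

lemma sum_residue_class:
  fixes f :: "nat \<Rightarrow> 'a :: comm_monoid_add"
  assumes "p > 0"
  shows "(\<Sum>j | j < q * p \<and> j mod p = i mod p. f j) = (\<Sum>t = 0..<q. f (i mod p + p * t))"
proof (rule sum.reindex_bij_witness[of _ "\<lambda>t. i mod p + p * t" "\<lambda>j. j div p"])
  fix t assume "t \<in> {0..<q}"
  then have "p * Suc t \<le> p * q" by (intro mult_le_mono) auto
  then have "i mod p + p * t < q * p"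
    using mod_less_divisor[OF assms, of i] by (simp add: mult.commute)
  then show "i mod p + p * t \<in> {j. j < q * p \<and> j mod p = i mod p}" by simp
next
  fix j assume "j \<in> {j. j < q * p \<and> j mod p = i mod p}"
  then show "j div p \<in> {0..<q}" "i mod p + p * (j div p) = j"
      "f (i mod p + p * (j div p)) = f j"
    using less_mult_imp_div_less[of j q p] mod_mult_div_eq[of j p] by auto
qed (use assms in auto)

text \<open>The 0/1 coefficients are row \<open>i\<close> of the adjacency matrix. The sum is the
  one over all \<open>j\<close> minus the one over the class of \<open>i\<close> modulo
  \<open>p\<close>, and both are geometric.\<close>

lemma sum_powers_noncongruent:
  fixes w :: "'a :: field"
  assumes w: "\<And>k. w ^ k = 1 \<longleftrightarrow> q * p dvd k" and "p > 0" "k < q * p"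
  shows "(\<Sum>j = 0..<q * p. (if j mod p = i mod p then 0 else 1) * w ^ (j * k)) =
    w ^ (i * k) * ((if k = 0 then of_nat (q * p) else 0) - (if q dvd k then of_nat q else 0))"
proof -
  have dvd: "w ^ (p * k) = 1 \<longleftrightarrow> q dvd k"
    using \<open>p > 0\<close> by (simp add: w mult.commute[of q])
  have "(\<Sum>j = 0..<q * p. (w ^ k) ^ j) = (if w ^ k = 1 then of_nat (q * p) else 0)"
    by (rule sum_powers_root_of_unity) (simp add: w flip: power_mult)
  also have "w ^ k = 1 \<longleftrightarrow> k = 0"
    using \<open>k < q * p\<close> by (auto simp: w dest: dvd_imp_le)
  \<comment> \<open>The factor \<open>w ^ (i * k)\<close> may be inserted, since it is 1 in the only
    nonzero case \<open>k = 0\<close>.\<close>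
  finally have all: "(\<Sum>j = 0..<q * p. w ^ (j * k)) = w ^ (i * k) * (if k = 0 then of_nat (q * p) else 0)"
    by (simp add: mult.commute[of _ k] power_mult)
  have "(\<Sum>j | j < q * p \<and> j mod p = i mod p. w ^ (j * k)) =
      (\<Sum>t = 0..<q. w ^ ((i mod p) * k) * (w ^ (p * k)) ^ t)"
    by (subst sum_residue_class[OF \<open>p > 0\<close>])
       (simp add: algebra_simps flip: power_mult power_add)
  also have "\<dots> = w ^ ((i mod p) * k) * (if w ^ (p * k) = 1 then of_nat q else 0)"
    by (subst sum_powers_root_of_unity[symmetric])
       (auto simp: w sum_distrib_left mult_ac simp flip: power_mult)
  also have "\<dots> = w ^ (i * k) * (if q dvd k then of_nat q else 0)"
  \<comment> \<open>If \<open>q\<close> divides \<open>k\<close>, then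
    \<open>w ^ (p * k) = 1\<close>, so \<open>i mod p\<close> can be replaced by \<open>i\<close> in
    the exponent; otherwise both sides vanish.\<close>
  proof (cases "q dvd k")
    case True
    have "w ^ (i * k) = w ^ ((i mod p + p * (i div p)) * k)"
      by (simp only: mod_mult_div_eq)
    also have "\<dots> = w ^ ((i mod p) * k) * (w ^ (p * k)) ^ (i div p)"
      by (simp only: distrib_left power_add mult_ac flip: power_mult)
    also have "w ^ (p * k) = 1" using True by (simp only: dvd)
    finally show ?thesis using True dvd by simp
  qed (simp add: dvd)
  finally have cls: "(\<Sum>j | j < q * p \<and> j mod p = i mod p. w ^ (j * k)) =
      w ^ (i * k) * (if q dvd k then of_nat q else 0)" .
  have "(\<Sum>j = 0..<q * p. (if j mod p = i mod p then 0 else 1) * w ^ (j * k)) =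
      (\<Sum>j = 0..<q * p. w ^ (j * k) - (if j mod p = i mod p then w ^ (j * k) else 0))"
    by (intro sum.cong) auto
  also have "\<dots> = (\<Sum>j = 0..<q * p. w ^ (j * k)) -
      (\<Sum>j | j < q * p \<and> j mod p = i mod p. w ^ (j * k))"
    by (simp add: sum_subtractf sum.inter_filter[symmetric])
  finally show ?thesis
    by (simp add: all cls right_diff_distrib)
qed

lemma image_mset_const_on:
  assumes "\<And>x. x \<in> A \<Longrightarrow> f x = c"
  shows "image_mset f (mset_set A) = replicate_mset (card A) c"
proof (cases "finite A")
  case True
  then have "image_mset f (mset_set A) = image_mset (\<lambda>_. c) (mset_set A)"
    using assms by (intro image_mset_cong) auto
  then show ?thesis by (simp add: image_mset_const_eq)
qed simp

lemma card_multiples_less: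
  assumes "q > 0"
  shows "card {k. k < q * p \<and> q dvd k} = (p :: nat)"
proof -
  have "{k. k < q * p \<and> q dvd k} = (*) q ` {..<p}"
    using assms by (auto elim!: dvdE)
  then show ?thesis
    using assms by (simp add: card_image inj_on_def)
qed

text \<open>There are \<open>p\<close> multiples of \<open>q\<close> below \<open>q * p\<close>. One
  of them is 0, which leaves \<open>p - 1\<close> for the value \<open>c\<close> and
  \<open>q * p - p\<close> non-multiples for \<open>b\<close>.\<close>

lemma image_mset_eigenvalues:
  fixes a b c :: 'a
  assumes "q > 0" "p > 0"
  shows "image_mset (\<lambda>k. if k = 0 then a else if q dvd k then c else b) (mset_set {0..<q * p}) =
    {#a#} + replicate_mset (q * p - p) b + replicate_mset (p - 1) c"
    (is "image_mset ?f _ = _")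
proof -
  define M where "M = {k. k < q * p \<and> q dvd k}"
  have fin: "finite M" and sub: "M \<subseteq> {0..<q * p}" and zero: "0 \<in> M"
    using assms by (auto simp: M_def)
  have card: "card M = p"
    using assms by (simp add: M_def card_multiples_less)
  have "{0..<q * p} = {0} \<union> ({0..<q * p} - M) \<union> (M - {0})"
    using sub zero by blast
  also have "mset_set \<dots> = mset_set {0} + mset_set ({0..<q * p} - M) + mset_set (M - {0})"
    using fin zero by (subst mset_set_Union; (subst mset_set_Union)?) auto
  finally have "image_mset ?f (mset_set {0..<q * p}) = {#a#} +
      image_mset ?f (mset_set ({0..<q * p} - M)) + image_mset ?f (mset_set (M - {0}))"
    by simp
  also have "image_mset ?f (mset_set ({0..<q * p} - M)) = replicate_mset (q * p - p) b"
  proof (subst image_mset_const_on)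
    show "?f x = b" if "x \<in> {0..<q * p} - M" for x
      using that by (auto simp: M_def)
  qed (simp add: card_Diff_subset[OF fin sub] card)
  also have "image_mset ?f (mset_set (M - {0})) = replicate_mset (p - 1) c"
  proof (subst image_mset_const_on)
    show "?f x = c" if "x \<in> M - {0}" for x
      using that by (auto simp: M_def)
  qed (simp add: zero card)
  finally show ?thesis .
qed

theorem corollary3p1:
  fixes p m n :: nat and S :: "int set"
  assumes "prime p" and "m \<ge> 1" and "n = p ^ m"
    and "S = {a \<in> carrier (integer_mod_group n). gcd a (int n) = 1}"
  shows "adjacency_spectrum (Cay (integer_mod_group n) S) =
    {# of_nat n - of_nat (p ^ (m - 1)) #}
    + replicate_mset (n - p) 0
    + replicate_mset (p - 1) (- of_nat (p ^ (m - 1)))"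
proof -
  define q where "q = p ^ (m - 1)"
  have p: "p > 0" and q: "q > 0"
    using \<open>prime p\<close> by (auto simp: q_def prime_gt_0_nat)
  have n: "n = q * p"
    using assms(2,3) by (cases m) (auto simp: q_def)
  have n0: "n > 0" using p q n by simp
  let ?vs = "map int [0..<n]"
  let ?G = "Cay (integer_mod_group n) S"
  have carrier: "carrier (integer_mod_group n) = {0..<int n}"
    using n0 by (simp add: carrier_integer_mod_group)
  have vs: "distinct ?vs" "set ?vs = pverts ?G"
    by (auto simp: distinct_map inj_on_def Cay_def carrier image_int_atLeastLessThan)
  \<comment> \<open>Reducing the difference modulo \<open>n\<close> does not affect coprimality to
    \<open>n\<close>. As \<open>m \<ge> 1\<close>, being coprime to \<open>p ^ m\<close> means being
    coprime to \<open>p\<close>, which for a prime means not being divisible by it.\<close>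
  have arc: "(int i, int j) \<in> parcs ?G \<longleftrightarrow> j mod p \<noteq> i mod p" if "i < n" "j < n" for i j
  proof -
    have "(- int i mod int n + int j) mod int n = (int j - int i) mod int n"
      by (simp add: mod_add_left_eq)
    then have "(int i, int j) \<in> parcs ?G \<longleftrightarrow> coprime ((int j - int i) mod int n) (int n)"
      using that by (simp add: Cay_def carrier assms(4) coprime_iff_gcd_eq_1 del: gcd_mod_left)
    also have "\<dots> \<longleftrightarrow> coprime (int j - int i) (int n)"
      using n0 by (simp add: coprime_mod_left_iff)
    also have "\<dots> \<longleftrightarrow> coprime (int j - int i) (int p)"
      using assms(2,3) by simp
    also have "\<dots> \<longleftrightarrow> \<not> int p dvd int j - int i"
      using \<open>prime p\<close> by (metis coprime_commute coprime_absorb_left not_prime_unit prime_imp_coprime prime_nat_int_transfer)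
    also have "\<dots> \<longleftrightarrow> j mod p \<noteq> i mod p"
      by (simp flip: mod_eq_dvd_iff zmod_int)
    finally show ?thesis .
  qed
  obtain w :: complex where w: "\<And>k. w ^ k = 1 \<longleftrightarrow> q * p dvd k"
    using primitive_root_of_unity_exists n0 n by metis
  have "proots (char_poly (adjacency_matrix ?G ?vs)) =
      image_mset (\<lambda>k. (if k = 0 then of_nat (q * p) else 0) - (if q dvd k then of_nat q else 0))
        (mset_set {0..<n})"
  proof (rule proots_char_poly_fourier)
    fix i k assume ik: "i < n" "k < n"
    have "(\<Sum>j = 0..<n. adjacency_matrix ?G ?vs $$ (i, j) * w ^ (j * k)) =
        (\<Sum>j = 0..<q * p. (if j mod p = i mod p then 0 else 1) * w ^ (j * k))"
      using ik by (intro sum.cong) (simp_all add: adjacency_matrix_def arc flip: n)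
    also have "\<dots> = w ^ (i * k) *
        ((if k = 0 then of_nat (q * p) else 0) - (if q dvd k then of_nat q else 0))"
      using w p ik n by (intro sum_powers_noncongruent) auto
    finally show "(\<Sum>j = 0..<n. adjacency_matrix ?G ?vs $$ (i, j) * w ^ (j * k)) = \<dots>" .
  qed (auto simp: adjacency_matrix_def w n)
  \<comment> \<open>At \<open>k = 0\<close> both terms contribute, because \<open>q\<close> divides
    0; this gives the simple eigenvalue \<open>n - q\<close>.\<close>
  also have "(\<lambda>k. (if k = 0 then of_nat (q * p) else 0) - (if q dvd k then of_nat q else 0)) =
      (\<lambda>k. if k = 0 then of_nat n - of_nat q else if q dvd k then - of_nat q else (0 :: complex))"
    by (auto simp: n)
  finally show ?thesis
    using image_mset_eigenvalues[OF q p]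
    by (simp only: adjacency_spectrum_eq[OF vs] q_def[symmetric] n[symmetric])
qed

end
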